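(* Let $D\ge 2$ be a fixed integer and let $\mathcal{T}$ be a $D$-ary tree on the index set $[N]$. For $\epsilon\in(0,1/2)$ and $k=\omega(\log N)$ there exists a $\mathcal{T}_k^{\epsilon}$-RIP-1 matrix, i.e. an adjacency matrix $\mathbf{A}\in\{0,1\}^{m\times N}$ (with $d$ ones per column) of a $(k,d,\epsilon)$-model expander graph for the model $\mathcal{T}_k$, with $$d=\mathcal{O}\left(\frac{\log(N/k)}{\epsilon\log\log(N/k)}\right)\quad\text{and}\quad m=\mathcal{O}\left(\frac{dk}{\epsilon}\right).$$
   Context: $[N]=\{1,\ldots,N\}$. The elements of $[N]$ are the nodes of a rooted $D$-ary tree $\mathcal{T}$. A $k$-rooted connected subtree of $\mathcal{T}$ is a set $\mathcal{K}$ of at most $k$ nodes such that for each element of $\mathcal{K}$ all its ancestors in $\mathcal{T}$ are also in $\mathcal{K}$ (so the root is in $\mathcal{K}$). The $k$-tree sparse model $\mathcal{T}_k$ is the collection of all $k$-rooted connected subtrees of $\mathcal{T}$. A bipartite graph $G=([N],[m],\mathcal{E})$ with left nodes $[N]$ and right nodes $[m]$, in which every left node has degree $d$, is a $(k,d,\epsilon)$-model expander for $\mathcal{T}_k$ if $|\Gamma(\mathcal{S})|\ge(1-\epsilon)d|\mathcal{S}|$ for every $\mathcal{S}\subseteq\mathcal{K}$ with $\mathcal{K}\in\mathcal{T}_k$, where $\Gamma(\mathcal{S})\subseteq[m]$ is the set of neighbours of $\mathcal{S}$. Its adjacency matrix is the $m\times N$ binary matrix with entry $(j,i)$ equal to $1$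 iff $j\in[m]$ is adjacent to $i\in[N]$. Such adjacency matrices are called $\mathcal{T}_k^{\epsilon}$-RIP-1 matrices. The asymptotic notation refers to $N\to\infty$ with $k=k(N)$ and $D$ fixed.
   Formalization: It is additionally assumed that N/k > e for all large N, so that log log(N/k) is defined and positive; without this (for example k = N) the bound on d is undefined or not positive. *)

theory Defs
  imports
    "HOL-Library.Landau_Symbols"
    "Jordan_Normal_Form.Matrix"
begin

text \<open>
  \<open>(u, v) \<in> E\<close> means that \<open>u\<close> is the parent of \<open>v\<close>.  A node of a \<open>D\<close>-ary tree has at most
  \<open>D\<close> children; no completeness is required.  Unique parents together with reachability from
  the parentless root exclude cycles.
\<close>
definition rooted_dary_tree :: "nat \<Rightarrow> 'a set \<Rightarrow> 'a \<Rightarrow> ('a \<times> 'a) set \<Rightarrow> bool" where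
  "rooted_dary_tree D V r E \<longleftrightarrow>
     finite V \<and> r \<in> V \<and> E \<subseteq> V \<times> V \<and>
     (\<forall>u. (u, r) \<notin> E) \<and>
     (\<forall>v \<in> V - {r}. \<exists>!u. (u, v) \<in> E) \<and>
     (\<forall>v \<in> V. (r, v) \<in> E\<^sup>*) \<and>
     (\<forall>u \<in> V. card (E `` {u}) \<le> D)"

definition ancestors :: "('a \<times> 'a) set \<Rightarrow> 'a \<Rightarrow> 'a set" where
  "ancestors E v = {u. (u, v) \<in> E\<^sup>+}"

definition rooted_connected_subtree ::
    "nat \<Rightarrow> 'a set \<Rightarrow> 'a \<Rightarrow> ('a \<times> 'a) set \<Rightarrow> 'a set \<Rightarrow> bool" where
  "rooted_connected_subtree k V r E K \<longleftrightarrow>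
     K \<subseteq> V \<and> card K \<le> k \<and> r \<in> K \<and> (\<forall>v \<in> K. ancestors E v \<subseteq> K)"

definition tree_sparse_model ::
    "nat \<Rightarrow> 'a set \<Rightarrow> 'a \<Rightarrow> ('a \<times> 'a) set \<Rightarrow> 'a set set" where
  "tree_sparse_model k V r E = {K. rooted_connected_subtree k V r E K}"

text \<open>
  A bipartite graph between \<open>{1..N}\<close> and \<open>{1..m}\<close> is given by its edge set \<open>G\<close>, with edges written
  as pairs (left node, right node), so that the neighbourhood of \<open>S\<close> is the image \<open>G `` S\<close>.
\<close>
definition left_regular_bipartite :: "nat \<Rightarrow> nat \<Rightarrow> nat \<Rightarrow> (nat \<times> nat) set \<Rightarrow> bool" where
  "left_regular_bipartite N m d G \<longleftrightarrow>
     G \<subseteq> {1..N} \<times> {1..m} \<and> (\<forall>i \<in> {1..N}. card (G `` {i}) = d)"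

text \<open>The sparsity \<open>k\<close> enters only through the model \<open>M\<close>.\<close>
definition model_expander ::
    "nat set set \<Rightarrow> nat \<Rightarrow> nat \<Rightarrow> nat \<Rightarrow> real \<Rightarrow> (nat \<times> nat) set \<Rightarrow> bool" where
  "model_expander M N m d \<epsilon> G \<longleftrightarrow>
     left_regular_bipartite N m d G \<and>
     (\<forall>K \<in> M. \<forall>S. S \<subseteq> K \<longrightarrow> real (card (G `` S)) \<ge> (1 - \<epsilon>) * real d * real (card S))"

text \<open>Matrix indices start at \<open>0\<close>, nodes at \<open>1\<close>; rows belong to right nodes.\<close>
definition adjacency_matrix :: "nat \<Rightarrow> nat \<Rightarrow> (nat \<times> nat) set \<Rightarrow> real mat" where
  "adjacency_matrix N m G = mat m N (\<lambda>(j, i). if (Suc i, Suc j) \<in> G then 1 else 0)"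

definition model_RIP1_matrix ::
    "nat set set \<Rightarrow> nat \<Rightarrow> nat \<Rightarrow> nat \<Rightarrow> real \<Rightarrow> real mat \<Rightarrow> bool" where
  "model_RIP1_matrix M N m d \<epsilon> A \<longleftrightarrow>
     (\<exists>G. model_expander M N m d \<epsilon> G \<and> A = adjacency_matrix N m G)"

end

theory Submission
  imports Defs
begin

text \<open>
  The graph is random. The right side is cut into \<open>d\<close> blocks of size \<open>q\<close>, and every left node
  picks one neighbour in each block, uniformly and independently; so left degrees are exactly \<open>d\<close>
  and \<open>m = d q\<close>. A set \<open>S\<close> of \<open>s\<close> nodes fails to expand only if at least \<open>\<epsilon> d s\<close> of its
  \<open>d s\<close> edges can be discarded without losing a neighbour, each of them running into a kept edge of
  \<open>S\<close> in the same block. Choosing the discarded edges and the edges they collide with shows that this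
  has probability at most \<open>(e s / (\<epsilon> q)) ^ c\<close> with \<open>c = \<lceil>\<epsilon> d s\<rceil>\<close>
  (lemmas \<open>card_small_image_le\<close> and \<open>exists_hash_with_large_images\<close>). With
  \<open>q\<close> about \<open>e\<^sup>2 k / \<epsilon>\<close> and \<open>t = k / s\<close> it is at most \<open>exp (- \<epsilon> d s (1 + ln t))\<close>.

  A union bound runs over the sets \<open>S\<close> below a member of the model. There are two estimates for
  the number of those of size \<open>s\<close>. One is \<open>(N choose s)\<close>, at most \<open>exp (s (1 + L + ln t))\<close> for
  \<open>L = ln (N / k)\<close>. The other uses the tree: for bounded arity there are only exponentially many (in
  \<open>k\<close>) rooted subtrees, whence at most \<open>2 ^ ((D + 2) k) \<le> exp (s (D + 2) t)\<close> sets
  (lemma \<open>card_subsets_of_model_le\<close>). The first is better for small sets (\<open>t > L\<close>), the second for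
  large ones (\<open>t \<le> L\<close>), and dividing the smaller of both exponents by \<open>1 + ln t\<close> never gives
  more than a constant times \<open>L / ln L\<close>; the critical value is \<open>t = L\<close> (lemma
  \<open>min_exponent_le\<close>). Hence \<open>\<epsilon> d\<close> of order \<open>L / ln L\<close> makes the expected number of failing sets of
  size \<open>s\<close> at most \<open>2\<^sup>-\<^sup>s\<close>, and the sum over \<open>s \<ge> 1\<close> stays below \<open>1\<close>.

  The argument applies once \<open>k \<ge> 1\<close> and \<open>N > e k\<close>, which holds for all large \<open>N\<close>. The remaining
  finitely many \<open>N\<close> do not affect the asymptotics, and a perfect matching serves there.
\<close>

section \<open>Counting rooted subtrees\<close>

text \<open>
  This is a percolation argument: keep a uniformly random set \<open>W\<close> of nodes. The root component of
  \<open>W\<close> is \<open>K\<close> exactly if \<open>K \<subseteq> W\<close> and \<open>W\<close> misses the children of \<open>K\<close> outside \<open>K\<close>. These events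
  are disjoint for different \<open>K\<close>, and each fixes the status of at most \<open>(D + 1) k\<close> nodes, so that
  it has probability at least \<open>2 ^ - ((D + 1) k)\<close>.
\<close>
lemma card_tree_sparse_model_le:
  assumes T: "rooted_dary_tree D V r E"
  shows "card (tree_sparse_model k V r E) \<le> 2 ^ ((D + 1) * k)"
proof -
  let ?T = "tree_sparse_model k V r E"
  define bd where "bd K = E `` K - K" for K
  define F where "F K = {W. K \<subseteq> W \<and> W \<subseteq> V \<and> W \<inter> bd K = {}}" for K
  have fV: "finite V" and EV: "E \<subseteq> V \<times> V" and deg: "\<And>u. u \<in> V \<Longrightarrow> card (E `` {u}) \<le> D"
    and reach: "\<And>v. v \<in> V \<Longrightarrow> (r, v) \<in> E\<^sup>*"
    using T by (auto simp: rooted_dary_tree_def)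
  have TV: "?T \<subseteq> Pow V"
    by (auto simp: tree_sparse_model_def rooted_connected_subtree_def)
  have finT: "finite ?T" using TV fV by (metis finite_Pow_iff finite_subset)
  have finF: "finite (F K)" for K
    using fV by (auto simp: F_def intro: finite_subset[of _ "Pow V"])
  \<comment> \<open>Following the path from the root, no node of \<open>K'\<close> can leave \<open>K\<close>: the first one to do so
      would be a child of \<open>K\<close> that \<open>W\<close> both contains and misses.\<close>
  have sub: "K' \<subseteq> K" if K: "K \<in> ?T" and K': "K' \<in> ?T" and W: "W \<in> F K" "W \<in> F K'" for K K' W
  proof
    fix v assume "v \<in> K'"
    have "(r, v) \<in> E\<^sup>*" using \<open>v \<in> K'\<close> K' TV reach by blast
    then show "v \<in> K" using \<open>v \<in> K'\<close>
    proof (induction rule: rtrancl_induct)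
      case base
      then show ?case using K by (auto simp: tree_sparse_model_def rooted_connected_subtree_def)
    next
      case (step u w)
      have "u \<in> K'"
        using K' step.prems step.hyps(2)
        by (auto simp: tree_sparse_model_def rooted_connected_subtree_def ancestors_def)
      then have "w \<in> E `` K" using step by blast
      moreover have "w \<notin> bd K" using W step.prems by (auto simp: F_def)
      ultimately show ?case by (auto simp: bd_def)
    qed
  qed
  have disj: "F K \<inter> F K' = {}" if "K \<in> ?T" "K' \<in> ?T" "K \<noteq> K'" for K K'
    using sub[OF that(1,2)] sub[OF that(2,1)] that(3) by blast
  have cardF: "2 ^ card V \<le> 2 ^ ((D + 1) * k) * card (F K)" if K: "K \<in> ?T" for K
  proof -
    have KV: "K \<subseteq> V" and Kk: "card K \<le> k"
      using K by (auto simp: tree_sparse_model_def rooted_connected_subtree_def)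
    have fK: "finite K" using KV fV finite_subset by blast
    have "card (E `` K) \<le> (\<Sum>u\<in>K. card (E `` {u}))"
      by (subst Image_eq_UN) (rule card_UN_le[OF fK])
    also have "\<dots> \<le> card K * D"
      using deg KV by (intro sum_bounded_above[where 'a = nat, simplified]) auto
    finally have EK: "card (E `` K) \<le> card K * D" .
    have "card (K \<union> bd K) \<le> card K + card (E `` K)"
      by (metis Un_Diff_cancel bd_def card_Un_le)
    also have "\<dots> \<le> (D + 1) * k"
      using EK mult_le_mono1[OF Kk, of "D + 1"] by (simp add: algebra_simps)
    finally have c: "card (K \<union> bd K) \<le> (D + 1) * k" .
    have "(\<union>) K ` Pow (V - (K \<union> bd K)) \<subseteq> F K"
      using KV by (auto simp: F_def bd_def)
    moreover have "inj_on ((\<union>) K) (Pow (V - (K \<union> bd K)))"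
      by (rule inj_onI) blast
    ultimately have "card (Pow (V - (K \<union> bd K))) \<le> card (F K)"
      using finF by (metis card_image card_mono)
    then have "2 ^ card (V - (K \<union> bd K)) \<le> card (F K)"
      using fV by (simp add: card_Pow)
    moreover have "card V \<le> (D + 1) * k + card (V - (K \<union> bd K))"
      using diff_card_le_card_Diff[of "K \<union> bd K" V] c
        finite_subset[of "K \<union> bd K" V] KV EV fV by (fastforce simp: bd_def)
    then have "(2::nat) ^ card V \<le> 2 ^ ((D + 1) * k) * 2 ^ card (V - (K \<union> bd K))"
      unfolding power_add[symmetric] by (intro power_increasing) auto
    ultimately show ?thesis
      by (meson le_trans mult_le_mono2)
  qed
  have "card ?T * 2 ^ card V = (\<Sum>K\<in>?T. 2 ^ card V)" by simp
  also have "\<dots> \<le> (\<Sum>K\<in>?T. 2 ^ ((D + 1) * k) * card (F K))"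
    by (intro sum_mono cardF)
  also have "\<dots> = 2 ^ ((D + 1) * k) * card (\<Union>K\<in>?T. F K)"
    using finT finF disj by (subst card_UN_disjoint) (auto simp: sum_distrib_left)
  also have "\<dots> \<le> 2 ^ ((D + 1) * k) * card (Pow V)"
    using fV by (intro mult_le_mono2 card_mono) (auto simp: F_def)
  finally show ?thesis using fV by (simp add: card_Pow)
qed

lemma card_subsets_of_model_le:
  assumes T: "rooted_dary_tree D V r E"
  shows "card {S. \<exists>K\<in>tree_sparse_model k V r E. S \<subseteq> K} \<le> 2 ^ ((D + 2) * k)"
proof -
  let ?T = "tree_sparse_model k V r E"
  have fV: "finite V" using T by (simp add: rooted_dary_tree_def)
  have K: "finite K \<and> card K \<le> k" if "K \<in> ?T" for K
    using that fV finite_subset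
    by (auto simp: tree_sparse_model_def rooted_connected_subtree_def)
  have finT: "finite ?T"
    using fV by (intro finite_subset[of ?T "Pow V"])
      (auto simp: tree_sparse_model_def rooted_connected_subtree_def)
  have "{S. \<exists>K\<in>?T. S \<subseteq> K} = (\<Union>K\<in>?T. Pow K)" by auto
  then have "card {S. \<exists>K\<in>?T. S \<subseteq> K} \<le> (\<Sum>K\<in>?T. card (Pow K))"
    using card_UN_le[OF finT, of Pow] by simp
  also have "\<dots> \<le> (\<Sum>K\<in>?T. 2 ^ k)"
    using K by (intro sum_mono) (simp add: card_Pow)
  also have "\<dots> \<le> 2 ^ ((D + 1) * k) * 2 ^ k"
    using card_tree_sparse_model_le[OF T] by simp
  also have "\<dots> = 2 ^ ((D + 2) * k)" by (simp flip: power_add)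
  finally show ?thesis .
qed

section \<open>Collisions of random choices\<close>

text \<open>From \<open>c! \<ge> (c / e) ^ c\<close>, which is the comparison of \<open>exp c\<close> with one term of its series.\<close>
lemma binomial_le_exp_power:
  assumes "c > 0"
  shows "real (n choose c) \<le> (exp 1 * real n / real c) ^ c"
proof -
  have "real c ^ c / fact c \<le> exp (real c)"
  proof -
    have "(\<Sum>i\<in>{c}. real c ^ i /\<^sub>R fact i) \<le> (\<Sum>i. real c ^ i /\<^sub>R fact i)"
      by (rule sum_le_suminf[OF summable_exp_generic]) auto
    then show ?thesis by (simp add: exp_def field_simps)
  qed
  then have fc: "real c ^ c \<le> exp 1 ^ c * fact c"
    by (simp add: divide_le_eq flip: exp_of_nat_mult)
  have "real (n choose c) * fact c \<le> real n ^ c"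
    using binomial_fact_pow[of n c] by (metis of_nat_fact of_nat_le_iff of_nat_mult of_nat_power)
  then have "real (n choose c) * fact c * real c ^ c \<le> real n ^ c * (exp 1 ^ c * fact c)"
    using fc by (intro mult_mono) auto
  then have "real (n choose c) * real c ^ c \<le> real n ^ c * exp 1 ^ c"
    by (simp add: mult.commute mult.left_commute)
  then show ?thesis
    using assms by (simp add: power_divide power_mult_distrib field_simps)
qed

text \<open>
  A function \<open>f\<close> on \<open>V \<times> J\<close> describes the choices of all nodes in \<open>V\<close>: node \<open>i\<close> chooses
  \<open>f (i, j)\<close> in block \<open>j\<close>. Recording the block keeps choices in different blocks apart, so the
  image of \<open>S \<times> J\<close> under \<open>hashed f\<close> is the set of neighbours of \<open>S\<close>.
\<close>
definition hashed :: "('a \<times> 'b \<Rightarrow> 'c) \<Rightarrow> 'a \<times> 'b \<Rightarrow> 'b \<times> 'c" where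
  "hashed f x = (snd x, f x)"

text \<open>
  Keep one edge \<open>R\<close> for each neighbour; among the others there are at least \<open>c\<close>, and each shares
  its endpoint with a kept edge, which lies in the same block. Only the node of that edge
  has to be recorded.
\<close>
lemma small_image_collisions:
  assumes S: "finite S" and J: "finite J"
    and small: "card (hashed f ` (S \<times> J)) + c \<le> card S * card J"
  obtains C g where "C \<subseteq> S \<times> J" "card C = c" "g \<in> C \<rightarrow>\<^sub>E S"
    "\<And>x. x \<in> C \<Longrightarrow> (g x, snd x) \<notin> C \<and> f x = f (g x, snd x)"
proof -
  let ?A = "S \<times> J"
  obtain R where R: "R \<subseteq> ?A" "inj_on (hashed f) R" "hashed f ` ?A = hashed f ` R"
    by (metis subset_image_inj subset_refl)
  have fA: "finite ?A" using S J by simp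
  have "card R = card (hashed f ` ?A)" using R by (metis card_image)
  then have "c \<le> card (?A - R)"
    using small R(1) fA by (simp add: card_Diff_subset card_cartesian_product finite_subset)
  then obtain C where C: "C \<subseteq> ?A - R" "card C = c"
    by (metis obtain_subset_with_card_n)
  define P where "P x i \<longleftrightarrow> i \<in> S \<and> (i, snd x) \<notin> C \<and> f x = f (i, snd x)" for x i
  have "\<exists>i. P x i" if "x \<in> C" for x
  proof -
    have "hashed f x \<in> hashed f ` R" using that C R(3) by blast
    then obtain y where "y \<in> R" "hashed f y = hashed f x" by force
    then have "P x (fst y)" using C R(1)
      by (cases y) (auto simp: P_def hashed_def)
    then show ?thesis ..
  qed
  then have "P x (SOME i. P x i)" if "x \<in> C" for x using that by (meson someI_ex)
  then show ?thesis
    using C by (intro that[of C "\<lambda>x\<in>C. SOME i. P x i"]) (auto simp: P_def)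
qed

text \<open>
  Once \<open>C\<close> and \<open>g\<close> from the previous lemma are chosen, \<open>f\<close> is determined by its values outside
  \<open>C\<close>. Hence every choice of \<open>(C, g)\<close> saves a factor \<open>card Q ^ c\<close>.
\<close>
lemma card_small_image_le:
  assumes V: "finite V" "S \<subseteq> V" and J: "finite J" and Q: "finite Q"
  shows "card {f \<in> V \<times> J \<rightarrow>\<^sub>E Q. card (hashed f ` (S \<times> J)) + c \<le> card S * card J}
    \<le> (card S * card J choose c) * card S ^ c * card Q ^ (card V * card J - c)"
    (is "card ?bad \<le> _")
proof -
  let ?A = "S \<times> J"
  define CC where "CC = {C. C \<subseteq> ?A \<and> card C = c}"
  define B where "B C g = {f \<in> V \<times> J \<rightarrow>\<^sub>E Q. \<forall>x\<in>C. (g x, snd x) \<notin> C \<and> f x = f (g x, snd x)}"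
    for C :: "('a \<times> 'b) set" and g
  have fS: "finite S" using V finite_subset by blast
  have fA: "finite ?A" using fS J by simp
  have finC: "finite C" if "C \<in> CC" for C
    using that fA finite_subset by (auto simp: CC_def)
  have finCC: "finite CC" using fA by (auto simp: CC_def intro: finite_subset[of _ "Pow ?A"])
  have finB: "finite (B C g)" for C g
    using V J Q by (auto simp: B_def intro: finite_subset[OF _ finite_PiE[of "V \<times> J" "\<lambda>_. Q"]])
  have cardB: "card (B C g) \<le> card Q ^ (card V * card J - c)" if C: "C \<in> CC" and g: "g \<in> C \<rightarrow>\<^sub>E S" for C g
  proof -
    have CV: "C \<subseteq> V \<times> J" using C V by (auto simp: CC_def)
    have mem: "(g x, snd x) \<in> V \<times> J" if "x \<in> C" for x
      using that C g V CV by (auto simp: PiE_iff)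
    have "inj_on (\<lambda>f. restrict f (V \<times> J - C)) (B C g)"
    proof (rule inj_onI)
      fix f h assume f: "f \<in> B C g" and h: "h \<in> B C g"
        and eq: "restrict f (V \<times> J - C) = restrict h (V \<times> J - C)"
      have out: "f y = h y" if "y \<in> V \<times> J - C" for y
        using eq that by (metis restrict_apply')
      show "f = h"
      proof (rule PiE_ext)
        show "f \<in> V \<times> J \<rightarrow>\<^sub>E Q" "h \<in> V \<times> J \<rightarrow>\<^sub>E Q" using f h by (auto simp: B_def)
        fix x assume x: "x \<in> V \<times> J"
        show "f x = h x"
        proof (cases "x \<in> C")
          case True
          then have "(g x, snd x) \<notin> C" "f x = f (g x, snd x)" "h x = h (g x, snd x)"
            using f h by (simp_all add: B_def)
          then show ?thesis using out mem[OF True] by auto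
        qed (use out x in auto)
      qed
    qed
    moreover have "(\<lambda>f. restrict f (V \<times> J - C)) ` B C g \<subseteq> (V \<times> J - C) \<rightarrow>\<^sub>E Q"
      unfolding image_subset_iff restrict_PiE_iff by (auto simp: B_def PiE_iff)
    moreover have "finite ((V \<times> J - C) \<rightarrow>\<^sub>E Q)"
      using V J Q by (intro finite_PiE) auto
    ultimately have "card (B C g) \<le> card ((V \<times> J - C) \<rightarrow>\<^sub>E Q)"
      by (metis card_inj_on_le)
    also have "\<dots> = card Q ^ (card V * card J - c)"
      using V J C CV finC[OF C]
      by (simp add: card_funcsetE card_Diff_subset card_cartesian_product CC_def)
    finally show ?thesis .
  qed
  have "?bad \<subseteq> (\<Union>C\<in>CC. \<Union>g\<in>C \<rightarrow>\<^sub>E S. B C g)"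
  proof
    fix f assume f: "f \<in> ?bad"
    then obtain C g where "C \<subseteq> ?A" "card C = c" "g \<in> C \<rightarrow>\<^sub>E S"
      "\<And>x. x \<in> C \<Longrightarrow> (g x, snd x) \<notin> C \<and> f x = f (g x, snd x)"
      using small_image_collisions[OF fS J, of f c] by blast
    then show "f \<in> (\<Union>C\<in>CC. \<Union>g\<in>C \<rightarrow>\<^sub>E S. B C g)"
      using f unfolding CC_def B_def by blast
  qed
  then have "card ?bad \<le> card (\<Union>C\<in>CC. \<Union>g\<in>C \<rightarrow>\<^sub>E S. B C g)"
    using finCC finC fS finB by (intro card_mono finite_UN_I finite_PiE) auto
  also have "\<dots> \<le> (\<Sum>C\<in>CC. card (\<Union>g\<in>C \<rightarrow>\<^sub>E S. B C g))"
    by (rule card_UN_le[OF finCC])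
  also have "\<dots> \<le> (\<Sum>C\<in>CC. card S ^ c * card Q ^ (card V * card J - c))"
  proof (rule sum_mono)
    fix C assume C: "C \<in> CC"
    have "card (\<Union>g\<in>C \<rightarrow>\<^sub>E S. B C g) \<le> (\<Sum>g\<in>C \<rightarrow>\<^sub>E S. card (B C g))"
      using finC[OF C] fS by (intro card_UN_le finite_PiE) auto
    also have "\<dots> \<le> (\<Sum>g\<in>C \<rightarrow>\<^sub>E S. card Q ^ (card V * card J - c))"
      by (intro sum_mono cardB C)
    also have "\<dots> = card S ^ c * card Q ^ (card V * card J - c)"
      using C finC[OF C] by (simp add: card_funcsetE CC_def)
    finally show "card (\<Union>g\<in>C \<rightarrow>\<^sub>E S. B C g) \<le> card S ^ c * card Q ^ (card V * card J - c)" .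
  qed
  also have "\<dots> = (card S * card J choose c) * card S ^ c * card Q ^ (card V * card J - c)"
    using n_subsets[OF fA] by (simp add: CC_def card_cartesian_product)
  finally show ?thesis .
qed

text \<open>
  The union bound. Each summand is an upper bound for the probability that \<open>S\<close> has too few
  neighbours, because \<open>(d s choose c) \<le> (e d s / c) ^ c \<le> (e / \<epsilon>) ^ c\<close> for \<open>c \<ge> \<epsilon> d s\<close>.
\<close>
lemma exists_hash_with_large_images:
  fixes \<epsilon> :: real
  assumes V: "finite V" and FF: "finite FF" "\<And>S. S \<in> FF \<Longrightarrow> S \<noteq> {} \<and> S \<subseteq> V"
    and \<epsilon>: "0 < \<epsilon>" "\<epsilon> \<le> 1" and dq: "d > 0" "q > 0"
    and fail: "(\<Sum>S\<in>FF. (exp 1 * real (card S) / (\<epsilon> * real q)) ^ nat \<lceil>\<epsilon> * real d * real (card S)\<rceil>) < 1"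
  shows "\<exists>f \<in> V \<times> {..<d} \<rightarrow>\<^sub>E {..<q}.
    \<forall>S\<in>FF. (1 - \<epsilon>) * real d * real (card S) \<le> real (card (hashed f ` (S \<times> {..<d})))"
proof (rule ccontr)
  let ?P = "V \<times> {..<d} \<rightarrow>\<^sub>E {..<q}"
  define c where "c S = nat \<lceil>\<epsilon> * real d * real (card S)\<rceil>" for S :: "'a set"
  define bad where "bad S = {f \<in> ?P. card (hashed f ` (S \<times> {..<d})) + c S \<le> card S * card {..<d}}" for S
  define M where "M = real q ^ (card V * d)"
  have M: "M > 0" using dq by (simp add: M_def)
  assume neg: "\<not> ?thesis"
  have finP: "finite ?P" using V by (intro finite_PiE) auto
  have cardP: "real (card ?P) = M"
    using V by (simp add: card_funcsetE card_cartesian_product M_def)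
  have finbad: "finite (bad S)" for S using finP by (simp add: bad_def)
  have "?P \<subseteq> (\<Union>S\<in>FF. bad S)"
  proof
    fix f assume f: "f \<in> ?P"
    with neg obtain S where S: "S \<in> FF"
      and less: "real (card (hashed f ` (S \<times> {..<d}))) < (1 - \<epsilon>) * real d * real (card S)"
      by (meson not_le)
    let ?h = "card (hashed f ` (S \<times> {..<d}))"
    have "\<epsilon> * real d * real (card S) \<le> real_of_int (int (card S * d) - int ?h)"
      using less by (simp add: algebra_simps)
    then have "\<lceil>\<epsilon> * real d * real (card S)\<rceil> \<le> int (card S * d) - int ?h"
      by (rule ceiling_le)
    moreover have "0 \<le> \<lceil>\<epsilon> * real d * real (card S)\<rceil>"
      using \<epsilon> by (auto intro!: mult_nonneg_nonneg simp: less_le_trans[OF _ mult_nonneg_nonneg])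
    ultimately have "int (?h + c S) \<le> int (card S * d)" by (simp add: c_def)
    then have "?h + c S \<le> card S * d" by (simp only: of_nat_le_iff)
    then show "f \<in> (\<Union>S\<in>FF. bad S)" using S f by (auto simp: bad_def)
  qed
  then have "card ?P \<le> card (\<Union>S\<in>FF. bad S)"
    using FF finbad by (intro card_mono) auto
  also have "\<dots> \<le> (\<Sum>S\<in>FF. card (bad S))" by (rule card_UN_le[OF FF(1)])
  finally have "M \<le> (\<Sum>S\<in>FF. real (card (bad S)))"
    unfolding cardP[symmetric] of_nat_sum[symmetric] of_nat_le_iff .
  also have "\<dots> \<le> (\<Sum>S\<in>FF. (exp 1 * real (card S) / (\<epsilon> * real q)) ^ c S * M)"
  proof (rule sum_mono)
    fix S assume "S \<in> FF"
    then have S: "S \<noteq> {}" "S \<subseteq> V" "finite S" using FF V finite_subset by blast+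
    define s where "s = card S"
    have s: "0 < s" "s \<le> card V" using S V by (auto simp: s_def card_gt_0_iff card_mono)
    have pos: "0 < \<epsilon> * real d * real s" using \<epsilon> dq s by simp
    have c0: "0 < c S" using pos by (simp add: c_def s_def)
    have cge: "\<epsilon> * real d * real s \<le> real (c S)" by (simp add: c_def s_def real_nat_ceiling_ge)
    have "\<epsilon> * (real d * real s) \<le> 1 * (real d * real s)" using \<epsilon> by (intro mult_right_mono) auto
    then have "\<lceil>\<epsilon> * real d * real s\<rceil> \<le> int (d * s)" by (simp add: ceiling_le_iff mult.assoc)
    then have "c S \<le> d * s" by (simp add: c_def s_def nat_le_iff)
    then have cle: "c S \<le> card V * d"
      using s by (metis le_trans mult.commute mult_le_mono2)
    have "card (bad S) \<le> (s * d choose c S) * s ^ c S * q ^ (card V * d - c S)"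
      using card_small_image_le[OF V S(2), of "{..<d}" "{..<q}" "c S"] by (simp add: bad_def s_def)
    then have "real (card (bad S)) \<le> real (s * d choose c S) * real s ^ c S * real q ^ (card V * d - c S)"
      by (metis of_nat_le_iff of_nat_mult of_nat_power)
    also have "\<dots> \<le> (exp 1 / \<epsilon>) ^ c S * real s ^ c S * real q ^ (card V * d - c S)"
    proof (intro mult_right_mono)
      have "real (s * d choose c S) \<le> (exp 1 * real (s * d) / real (c S)) ^ c S"
        by (rule binomial_le_exp_power[OF c0])
      also have "\<dots> \<le> (exp 1 / \<epsilon>) ^ c S"
        using cge c0 \<epsilon> by (intro power_mono) (auto simp: field_simps)
      finally show "real (s * d choose c S) \<le> (exp 1 / \<epsilon>) ^ c S" .
    qed auto
    also have "\<dots> = (exp 1 * real s / (\<epsilon> * real q)) ^ c S * M"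
      using cle dq \<epsilon> by (simp add: M_def power_diff field_simps)
    finally show "real (card (bad S)) \<le> (exp 1 * real (card S) / (\<epsilon> * real q)) ^ c S * M"
      by (simp add: s_def)
  qed
  also have "\<dots> < M"
    using mult_strict_right_mono[OF fail M] by (simp add: sum_distrib_right c_def)
  finally show False by simp
qed

section \<open>The graph of a hash function\<close>

text \<open>
  Block \<open>j\<close> occupies the right nodes \<open>j q + 1, \<dots>, (j + 1) q\<close>, since right nodes are numbered from
  \<open>1\<close> whereas blocks and positions inside a block start at \<open>0\<close>.
\<close>
definition hash_graph :: "nat \<Rightarrow> nat \<Rightarrow> nat \<Rightarrow> (nat \<times> nat \<Rightarrow> nat) \<Rightarrow> (nat \<times> nat) set" where
  "hash_graph N d q f = {(i, Suc (j * q + f (i, j))) | i j. i \<in> {1..N} \<and> j < d}"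

lemma card_hash_graph_Image:
  assumes f: "f \<in> {1..N} \<times> {..<d} \<rightarrow>\<^sub>E {..<q}" and S: "S \<subseteq> {1..N}"
  shows "card (hash_graph N d q f `` S) = card (hashed f ` (S \<times> {..<d}))"
proof -
  have "hash_graph N d q f `` S = {Suc (j * q + f (i, j)) | i j. i \<in> S \<and> j < d}"
    using S unfolding hash_graph_def by blast
  also have "\<dots> = (\<lambda>(j, x). Suc (j * q + x)) ` hashed f ` (S \<times> {..<d})"
    unfolding image_image hashed_def by (auto simp: image_iff) blast+
  finally have "hash_graph N d q f `` S = (\<lambda>(j, x). Suc (j * q + x)) ` hashed f ` (S \<times> {..<d})" .
  moreover have "inj_on (\<lambda>(j, x). Suc (j * q + x)) (UNIV \<times> {..<q})"
  proof (rule inj_onI; clarsimp)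
    fix j x j' x' :: nat assume "j * q + x = j' * q + x'" "x < q" "x' < q"
    then have "(j * q + x) div q = (j' * q + x') div q" "(j * q + x) mod q = (j' * q + x') mod q"
      by simp_all
    then show "j = j' \<and> x = x'" using \<open>x < q\<close> \<open>x' < q\<close> by simp
  qed
  moreover have "hashed f ` (S \<times> {..<d}) \<subseteq> UNIV \<times> {..<q}"
    using f S by (auto simp: hashed_def PiE_iff)
  ultimately show ?thesis by (metis card_image inj_on_subset)
qed

lemma left_regular_hash_graph:
  assumes f: "f \<in> {1..N} \<times> {..<d} \<rightarrow>\<^sub>E {..<q}"
  shows "left_regular_bipartite N (d * q) d (hash_graph N d q f)"
proof -
  have "Suc (j * q + f (i, j)) \<le> d * q" if "i \<in> {1..N}" "j < d" for i j
  proof -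
    have "f (i, j) < q" using f that by (auto simp: PiE_iff)
    then have "Suc (j * q + f (i, j)) \<le> Suc j * q" by simp
    also have "\<dots> \<le> d * q" using that by (intro mult_le_mono1) simp
    finally show ?thesis .
  qed
  then have "hash_graph N d q f \<subseteq> {1..N} \<times> {1..d * q}"
    by (auto simp: hash_graph_def)
  moreover have "card (hash_graph N d q f `` {i}) = d" if "i \<in> {1..N}" for i
  proof -
    have "inj_on (hashed f) ({i} \<times> {..<d})" by (auto simp: inj_on_def hashed_def)
    then show ?thesis
      using that by (subst card_hash_graph_Image[OF f]) (auto simp: card_image card_cartesian_product)
  qed
  ultimately show ?thesis by (auto simp: left_regular_bipartite_def)
qed

section \<open>The choice of the degree\<close>

lemma div_1_plus_ln_mono:
  fixes t L :: real
  assumes "1 \<le> t" "t \<le> L"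
  shows "t / (1 + ln t) \<le> L / (1 + ln L)"
proof -
  have "ln (L / t) \<le> L / t - 1" using assms by (intro ln_le_minus_one) auto
  then have "t * (ln L - ln t) \<le> L - t"
    using assms by (simp add: ln_div field_simps)
  moreover have "0 \<le> (L - t) * ln t" using assms by simp
  ultimately have "t * (1 + ln L) \<le> L * (1 + ln t)" by (simp add: algebra_simps)
  moreover have "0 < 1 + ln t" "0 < 1 + ln L" using assms by (simp_all add: add_pos_nonneg)
  ultimately show ?thesis by (simp add: field_simps)
qed

text \<open>
  Here \<open>\<beta>\<close> stands for \<open>\<epsilon> d\<close>, and the summand \<open>1\<close> is the surplus that makes the failure
  probabilities summable over the sizes. If \<open>t \<le> L\<close>, the term \<open>a t\<close> is small enough,
  because \<open>t / (1 + ln t)\<close> increases up to its value at \<open>L\<close>. If \<open>t > L\<close>, then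
  \<open>1 + ln t\<close> already exceeds \<open>ln L\<close>, and each of \<open>L\<close>, \<open>1 + ln t\<close> and \<open>1\<close> is covered by one
  multiple of \<open>L / ln L\<close>.
\<close>
lemma min_exponent_le:
  fixes t L a \<beta> :: real
  assumes t: "1 \<le> t" and L: "1 < L" and a: "1 \<le> a" and \<beta>: "(a + 2) * (L / ln L) \<le> \<beta>"
  shows "min (1 + L + ln t) (a * t) + 1 \<le> \<beta> * (1 + ln t)"
proof -
  have lnL: "0 < ln L" "ln L \<le> L - 1" using L by (auto intro: ln_le_minus_one)
  have lnt: "0 \<le> ln t" using t by simp
  have r: "1 \<le> L / ln L" using lnL L by (simp add: field_simps)
  show ?thesis
  proof (cases "t \<le> L")
    case True
    have "t / (1 + ln t) \<le> L / (1 + ln L)" using div_1_plus_ln_mono[OF t True] .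
    also have "\<dots> \<le> L / ln L" using lnL L by (simp add: frac_le)
    finally have "t \<le> L / ln L * (1 + ln t)" using lnt by (simp add: field_simps add_pos_nonneg)
    then have "(a + 2) * t \<le> (a + 2) * (L / ln L) * (1 + ln t)"
      using mult_left_mono[of t _ "a + 2"] a by (simp only: mult.assoc)
    also have "\<dots> \<le> \<beta> * (1 + ln t)" using \<beta> lnt by (intro mult_right_mono) auto
    finally show ?thesis using t a by (simp add: algebra_simps min_def)
  next
    case False
    then have "ln L \<le> ln t" using L by simp
    then have "L / ln L * ln L \<le> L / ln L * (1 + ln t)" using r by (intro mult_left_mono) auto
    then have "L \<le> L / ln L * (1 + ln t)" using lnL by simp
    moreover have "1 * (1 + ln t) \<le> L / ln L * (1 + ln t)" using r lnt by (intro mult_right_mono) auto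
    moreover have "ln t + 1 \<le> L / ln L * (1 + ln t)" using calculation by simp
    moreover have "3 * (L / ln L) * (1 + ln t) \<le> \<beta> * (1 + ln t)"
    proof (intro mult_right_mono)
      have "3 * (L / ln L) \<le> (a + 2) * (L / ln L)" using a r by (intro mult_right_mono) auto
      then show "3 * (L / ln L) \<le> \<beta>" using \<beta> by simp
    qed (use lnt in auto)
    ultimately show ?thesis using lnt by (simp add: min_def)
  qed
qed

text \<open>
  The expected number of failing sets of size \<open>s\<close>, where \<open>n\<close> is the number of sets to consider.
  The constant \<open>exp 2\<close> in \<open>q\<close> turns the base of the power into \<open>exp (- (1 + ln (k / s)))\<close>; without
  the extra \<open>1\<close> the bound would be void at \<open>s = k\<close>.
\<close>
lemma failure_term_le:
  fixes \<epsilon> L :: real and n :: nat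
  assumes s: "1 \<le> s" "s \<le> k" and N: "0 < N" and L: "L = ln (real N / real k)" "1 < L"
    and \<epsilon>: "0 < \<epsilon>"
    and d: "(real D + 4) * (L / ln L) \<le> \<epsilon> * real d"
    and q: "exp 2 * real k / \<epsilon> \<le> real q"
    and n: "n \<le> N choose s" "n \<le> 2 ^ ((D + 2) * k)"
    and c: "\<epsilon> * real d * real s \<le> real c"
  shows "real n * (exp 1 * real s / (\<epsilon> * real q)) ^ c \<le> (1 / 2) ^ s"
proof -
  define t where "t = real k / real s"
  have k: "0 < k" using s by simp
  have t: "1 \<le> t" "real k = t * real s" using s by (auto simp: t_def)
  have lnt: "0 \<le> ln t" using t by simp
  have qp: "0 < real q" using q k \<epsilon> by (smt (verit) divide_pos_pos exp_gt_zero mult_pos_pos of_nat_0_less_iff)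
  have e2: "exp (2::real) = exp 1 * exp 1" by (simp flip: exp_add)
  have et: "exp (- (1 + ln t)) = 1 / (exp 1 * t)"
    using t(1) by (simp add: exp_minus exp_add inverse_eq_divide del: minus_add_distrib)
  have "exp 2 * real k \<le> \<epsilon> * real q" using q \<epsilon> by (simp add: field_simps)
  then have "exp 1 * real s / (\<epsilon> * real q) \<le> exp 1 * real s / (exp 2 * real k)"
    using k qp \<epsilon> by (intro divide_left_mono mult_pos_pos) auto
  also have "\<dots> = exp (- (1 + ln t))"
    unfolding et e2 using s k by (simp add: t_def)
  finally have base: "exp 1 * real s / (\<epsilon> * real q) \<le> exp (- (1 + ln t))" .
  have "(exp 1 * real s / (\<epsilon> * real q)) ^ c \<le> exp (- (1 + ln t)) ^ c"
    using base \<epsilon> by (intro power_mono) auto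
  also have "\<dots> = exp (- (real c * (1 + ln t)))" by (simp add: algebra_simps flip: exp_of_nat_mult)
  also have "\<dots> \<le> exp (- (\<epsilon> * real d * real s * (1 + ln t)))"
    using mult_right_mono[OF c, of "1 + ln t"] lnt by simp
  finally have pw: "(exp 1 * real s / (\<epsilon> * real q)) ^ c \<le> exp (- (\<epsilon> * real d * real s * (1 + ln t)))" .
  have "real n \<le> real (N choose s)" using n(1) by simp
  also have "\<dots> \<le> (exp 1 * real N / real s) ^ s"
    using s by (intro binomial_le_exp_power) simp
  also have "exp 1 * real N / real s = exp 1 * exp L * exp (ln t)"
    using s k N t(1) by (simp add: L(1)) (simp add: t_def)
  also have "\<dots> = exp (1 + L + ln t)" by (simp only: exp_add)
  also have "\<dots> ^ s = exp (real s * (1 + L + ln t))" by (simp only: exp_of_nat_mult)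
  finally have n1: "real n \<le> exp (real s * (1 + L + ln t))" .
  have "real n \<le> real (2 ^ ((D + 2) * k))" using n(2) by (simp only: of_nat_le_iff)
  also have "\<dots> = 2 ^ ((D + 2) * k)" by simp
  also have "\<dots> \<le> exp 1 ^ ((D + 2) * k)"
    using exp_ge_add_one_self[of 1] by (intro power_mono) auto
  also have "\<dots> = exp (real ((D + 2) * k) * 1)" by (simp only: exp_of_nat_mult)
  also have "real ((D + 2) * k) * 1 = real s * ((real D + 2) * t)"
    by (simp add: t(2) algebra_simps)
  finally have n2: "real n \<le> exp (real s * ((real D + 2) * t))" .
  define \<mu> where "\<mu> = min (1 + L + ln t) ((real D + 2) * t)"
  have "real n \<le> exp (real s * \<mu>)"
    using n1 n2 by (simp add: \<mu>_def min_def)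
  then have "real n * (exp 1 * real s / (\<epsilon> * real q)) ^ c
    \<le> exp (real s * \<mu>) * exp (- (\<epsilon> * real d * real s * (1 + ln t)))"
    using pw \<epsilon> by (intro mult_mono) auto
  also have "\<dots> = exp (real s * \<mu> + - (\<epsilon> * real d * real s * (1 + ln t)))"
    by (simp only: exp_add)
  also have "\<dots> \<le> exp (real s * (- 1))"
  proof -
    have "\<mu> + 1 \<le> \<epsilon> * real d * (1 + ln t)"
      using min_exponent_le[OF t(1) L(2), of "real D + 2" "\<epsilon> * real d"] d
      by (simp add: \<mu>_def add.assoc)
    then have "real s * (\<mu> + 1) \<le> real s * (\<epsilon> * real d * (1 + ln t))"
      by (intro mult_left_mono) auto
    then show ?thesis by (simp add: algebra_simps)
  qed
  also have "\<dots> = exp (- 1) ^ s" by (simp only: exp_of_nat_mult)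
  also have "\<dots> \<le> (1 / 2) ^ s"
  proof (rule power_mono)
    have "2 \<le> exp (1::real)" using exp_ge_add_one_self[of 1] by simp
    then show "exp (- 1) \<le> (1 / 2 :: real)" by (simp add: exp_minus inverse_eq_divide frac_le)
  qed simp
  finally show ?thesis .
qed

section \<open>Existence of expanders for the tree model\<close>

text \<open>
  The constants exceed those of the estimates above by one, to absorb the rounding of \<open>d\<close> and
  \<open>q\<close> to integers: both \<open>L / (\<epsilon> ln L)\<close> and \<open>k / \<epsilon>\<close> are at least \<open>1\<close>.
\<close>
lemma exists_tree_model_expander:
  fixes \<epsilon> :: real
  assumes T: "rooted_dary_tree D {1..N} r E" and \<epsilon>: "0 < \<epsilon>" "\<epsilon> \<le> 1"
    and k: "1 \<le> k" "exp 1 * real k < real N" and L: "L = ln (real N / real k)"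
  shows "\<exists>d m G. 1 \<le> d \<and> model_expander (tree_sparse_model k {1..N} r E) N m d \<epsilon> G \<and>
    real d \<le> (real D + 5) * (L / (\<epsilon> * ln L)) \<and>
    real m \<le> (exp 2 + 1) * (real d * real k / \<epsilon>)"
proof -
  let ?T = "tree_sparse_model k {1..N} r E"
  have "exp 1 < real N / real k" using k by (simp add: field_simps)
  then have "ln (exp 1) < L" unfolding L by (subst ln_less_cancel_iff) (auto intro: less_trans[of 0 "exp 1"])
  then have L1: "1 < L" by simp
  then have lnL: "0 < ln L" "ln L \<le> L - 1" by (auto intro: ln_le_minus_one)
  define X where "X = L / (\<epsilon> * ln L)"
  have \<epsilon>X: "\<epsilon> * X = L / ln L" using \<epsilon> by (simp add: X_def)
  have "\<epsilon> * ln L \<le> 1 * ln L" using \<epsilon> lnL by (intro mult_right_mono) auto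
  then have "\<epsilon> * ln L \<le> L" using lnL by linarith
  then have X1: "1 \<le> X" using lnL \<epsilon> by (simp add: X_def)
  define d where "d = nat \<lceil>(real D + 4) * X\<rceil>"
  have dge: "(real D + 4) * X \<le> real d" by (simp add: d_def real_nat_ceiling_ge)
  have "1 * 1 \<le> (real D + 4) * X" using X1 by (intro mult_mono) auto
  then have d1: "1 \<le> d" using dge by simp
  have "real d \<le> (real D + 4) * X + 1" using X1 by (simp add: d_def)
  then have dle: "real d \<le> (real D + 5) * X" using X1 by (simp add: algebra_simps)
  define q where "q = nat \<lceil>exp 2 * real k / \<epsilon>\<rceil>"
  have qge: "exp 2 * real k / \<epsilon> \<le> real q" by (simp add: q_def real_nat_ceiling_ge)
  moreover have "0 < exp 2 * real k / \<epsilon>" using k \<epsilon> by simp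
  ultimately have q0: "0 < q" using of_nat_0_less_iff less_le_trans by blast
  have "1 \<le> real k / \<epsilon>" using k \<epsilon> by simp
  moreover have "real q \<le> exp 2 * real k / \<epsilon> + 1" using k \<epsilon> by (simp add: q_def)
  ultimately have qle: "real q \<le> (exp 2 + 1) * (real k / \<epsilon>)" by (simp add: algebra_simps)
  define FF where "FF = {S. S \<noteq> {} \<and> (\<exists>K\<in>?T. S \<subseteq> K)}"
  define h where "h s = (exp 1 * real s / (\<epsilon> * real q)) ^ nat \<lceil>\<epsilon> * real d * real s\<rceil>" for s
  have TK: "K \<subseteq> {1..N} \<and> card K \<le> k" if "K \<in> ?T" for K
    using that by (auto simp: tree_sparse_model_def rooted_connected_subtree_def)
  have FFV: "S \<noteq> {} \<and> S \<subseteq> {1..N}" if "S \<in> FF" for S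
    using that TK by (fastforce simp: FF_def)
  have finFF: "finite FF" using FFV by (intro finite_subset[of FF "Pow {1..N}"]) auto
  have FFs: "card ` FF \<subseteq> {1..k}"
  proof
    fix s assume "s \<in> card ` FF"
    then obtain S K where S: "s = card S" "S \<in> FF" "K \<in> ?T" "S \<subseteq> K" by (auto simp: FF_def)
    have "finite K" using TK S finite_subset by blast
    then have "card S \<le> k" using S TK card_mono le_trans by metis
    moreover have "finite S" using FFV S finite_subset by blast
    ultimately show "s \<in> {1..k}" using S FFV by (simp add: Suc_le_eq card_gt_0_iff)
  qed
  have "(\<Sum>S\<in>FF. h (card S)) = (\<Sum>s\<in>{1..k}. \<Sum>S\<in>{S\<in>FF. card S = s}. h (card S))"
    by (rule sum.group[symmetric, OF finFF _ FFs]) simp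
  also have "\<dots> = (\<Sum>s\<in>{1..k}. real (card {S\<in>FF. card S = s}) * h s)" by simp
  also have "\<dots> \<le> (\<Sum>s\<in>{1..k}. (1 / 2) ^ s)"
  proof (rule sum_mono)
    fix s assume s: "s \<in> {1..k}"
    have "card {S\<in>FF. card S = s} \<le> card {S. S \<subseteq> {1..N} \<and> card S = s}"
      using FFV by (intro card_mono) (auto intro: finite_subset[of _ "Pow {1..N}"])
    then have n1: "card {S\<in>FF. card S = s} \<le> N choose s" using n_subsets[of "{1..N}" s] by simp
    have "card {S\<in>FF. card S = s} \<le> card {S. \<exists>K\<in>?T. S \<subseteq> K}"
    proof (rule card_mono)
      show "finite {S. \<exists>K\<in>?T. S \<subseteq> K}"
        by (rule finite_subset[of _ "Pow {1..N}"]) (use TK in blast, simp)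
    qed (auto simp: FF_def)
    also have "\<dots> \<le> 2 ^ ((D + 2) * k)" by (rule card_subsets_of_model_le[OF T])
    finally have n2: "card {S\<in>FF. card S = s} \<le> 2 ^ ((D + 2) * k)" .
    have N0: "0 < N" using k(2) by (cases N) (auto simp: mult_less_0_iff)
    have "(real D + 4) * (L / ln L) = \<epsilon> * ((real D + 4) * X)" by (simp flip: \<epsilon>X)
    also have "\<dots> \<le> \<epsilon> * real d" using dge \<epsilon> by (intro mult_left_mono) auto
    finally have dd: "(real D + 4) * (L / ln L) \<le> \<epsilon> * real d" .
    show "real (card {S\<in>FF. card S = s}) * h s \<le> (1 / 2) ^ s"
      unfolding h_def
      by (rule failure_term_le[OF _ _ N0 L L1 \<epsilon>(1) dd qge n1 n2]) (use s in \<open>auto simp: real_nat_ceiling_ge\<close>)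
  qed
  also have "\<dots> = 1 - (1 / 2) ^ k" by (induction k) (simp_all add: field_simps)
  also have "\<dots> < 1" by simp
  finally have "(\<Sum>S\<in>FF. h (card S)) < 1" .
  then obtain f where f: "f \<in> {1..N} \<times> {..<d} \<rightarrow>\<^sub>E {..<q}"
    and large: "\<And>S. S \<in> FF \<Longrightarrow> (1 - \<epsilon>) * real d * real (card S) \<le> real (card (hashed f ` (S \<times> {..<d})))"
    using exists_hash_with_large_images[OF _ finFF FFV \<epsilon> _ q0, of d] d1
    unfolding h_def by auto
  have "model_expander ?T N (d * q) d \<epsilon> (hash_graph N d q f)"
    unfolding model_expander_def
  proof (intro conjI ballI allI impI)
    show "left_regular_bipartite N (d * q) d (hash_graph N d q f)"
      by (rule left_regular_hash_graph[OF f])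
    fix K S assume KS: "K \<in> ?T" "S \<subseteq> K"
    show "(1 - \<epsilon>) * real d * real (card S) \<le> real (card (hash_graph N d q f `` S))"
    proof (cases "S = {}")
      case False
      then have "S \<in> FF" using KS by (auto simp: FF_def)
      then show ?thesis using large FFV card_hash_graph_Image[OF f] by metis
    qed simp
  qed
  moreover have "real (d * q) \<le> (exp 2 + 1) * (real d * real k / \<epsilon>)"
    using mult_left_mono[OF qle, of "real d"] by (simp add: mult_ac)
  ultimately show ?thesis using d1 dle unfolding X_def by blast
qed

lemma model_expander_Id_on:
  assumes M: "\<And>K. K \<in> M \<Longrightarrow> K \<subseteq> {1..N}" and \<epsilon>: "0 \<le> \<epsilon>"
  shows "model_expander M N N 1 \<epsilon> (Id_on {1..N})"
  unfolding model_expander_def left_regular_bipartite_def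
proof (intro conjI ballI allI impI)
  fix K S assume "K \<in> M" "S \<subseteq> K"
  then have "S \<subseteq> {1..N}" using M by blast
  then have "Id_on {1..N} `` S = S" by auto
  moreover have "(1 - \<epsilon>) * real (card S) \<le> 1 * real (card S)"
    using \<epsilon> by (intro mult_right_mono) auto
  ultimately show "(1 - \<epsilon>) * real 1 * real (card S) \<le> real (card (Id_on {1..N} `` S))" by simp
next
  fix i assume "i \<in> {1..N}"
  then have "Id_on {1..N} `` {i} = {i}" by auto
  then show "card (Id_on {1..N} `` {i}) = 1" by simp
qed auto

theorem theorem4p2:
  fixes D :: nat
    and root :: "nat \<Rightarrow> nat"
    and E :: "nat \<Rightarrow> (nat \<times> nat) set"
    and k :: "nat \<Rightarrow> nat"
    and \<epsilon> :: "nat \<Rightarrow> real"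
  assumes "D \<ge> 2"
    and "\<And>N. N \<ge> 1 \<Longrightarrow> rooted_dary_tree D {1..N} (root N) (E N)"
    and "\<And>N. 0 < \<epsilon> N \<and> \<epsilon> N < 1 / 2"
    and "(\<lambda>N. real (k N)) \<in> \<omega>(\<lambda>N. ln (real N))"
    and "eventually (\<lambda>N. exp 1 * real (k N) < real N) sequentially"
  shows "\<exists>(d :: nat \<Rightarrow> nat) (m :: nat \<Rightarrow> nat) (A :: nat \<Rightarrow> real mat).
    (\<forall>N \<ge> 1. d N \<ge> 1 \<and>
       model_RIP1_matrix (tree_sparse_model (k N) {1..N} (root N) (E N)) N (m N) (d N) (\<epsilon> N) (A N)) \<and>
    (\<lambda>N. real (d N)) \<in>
      O(\<lambda>N. ln (real N / real (k N)) / (\<epsilon> N * ln (ln (real N / real (k N))))) \<and>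
    (\<lambda>N. real (m N)) \<in> O(\<lambda>N. real (d N) * real (k N) / \<epsilon> N)"
proof -
  let ?M = "\<lambda>N. tree_sparse_model (k N) {1..N} (root N) (E N)"
  let ?L = "\<lambda>N. ln (real N / real (k N))"
  define large where "large N \<longleftrightarrow> 1 \<le> N \<and> 1 \<le> k N \<and> exp 1 * real (k N) < real N" for N
  have "\<exists>d m A. 1 \<le> N \<longrightarrow> 1 \<le> d \<and> model_RIP1_matrix (?M N) N m d (\<epsilon> N) A \<and>
      (large N \<longrightarrow> real d \<le> (real D + 5) * (?L N / (\<epsilon> N * ln (?L N))) \<and>
        real m \<le> (exp 2 + 1) * (real d * real (k N) / \<epsilon> N))" for N
  proof (cases "large N")
    case True
    then have "\<exists>d m G. 1 \<le> d \<and> model_expander (?M N) N m d (\<epsilon> N) G \<and>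
        real d \<le> (real D + 5) * (?L N / (\<epsilon> N * ln (?L N))) \<and>
        real m \<le> (exp 2 + 1) * (real d * real (k N) / \<epsilon> N)"
      using assms(2,3)[of N] by (intro exists_tree_model_expander) (auto simp: large_def)
    then show ?thesis unfolding model_RIP1_matrix_def by blast
  next
    case False
    have "model_expander (?M N) N N 1 (\<epsilon> N) (Id_on {1..N})"
      using assms(3)[of N]
      by (intro model_expander_Id_on) (auto simp: tree_sparse_model_def rooted_connected_subtree_def)
    then show ?thesis using False unfolding model_RIP1_matrix_def by blast
  qed
  then obtain d m A where
    RIP: "\<And>N. 1 \<le> N \<Longrightarrow> 1 \<le> d N \<and> model_RIP1_matrix (?M N) N (m N) (d N) (\<epsilon> N) (A N)" and
    d: "\<And>N. large N \<Longrightarrow> real (d N) \<le> (real D + 5) * (?L N / (\<epsilon> N * ln (?L N)))" and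
    m: "\<And>N. large N \<Longrightarrow> real (m N) \<le> (exp 2 + 1) * (real (d N) * real (k N) / \<epsilon> N)"
    unfolding large_def by metis
  have "eventually (\<lambda>N. 1 * norm (ln (real N)) \<le> norm (real (k N))) sequentially"
    using assms(4) by (rule landau_omega.smallD) simp
  then have ev: "eventually large sequentially"
    using assms(5) eventually_ge_at_top[of 2]
  proof eventually_elim
    case (elim N)
    then have "0 < ln (real N)" by simp
    then have "0 < k N" using elim by (cases "k N") auto
    then show ?case using elim by (simp add: large_def)
  qed
  have "(\<lambda>N. real (d N)) \<in> O(\<lambda>N. ?L N / (\<epsilon> N * ln (?L N)))"
  proof (rule bigoI)
    show "eventually (\<lambda>N. norm (real (d N)) \<le> (real D + 5) * norm (?L N / (\<epsilon> N * ln (?L N)))) sequentially"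
      using ev
    proof eventually_elim
      case (elim N)
      have "(real D + 5) * (?L N / (\<epsilon> N * ln (?L N))) \<le> (real D + 5) * norm (?L N / (\<epsilon> N * ln (?L N)))"
        by (intro mult_left_mono) (auto simp del: abs_divide)
      then show ?case using d[OF elim] by simp
    qed
  qed
  moreover have "(\<lambda>N. real (m N)) \<in> O(\<lambda>N. real (d N) * real (k N) / \<epsilon> N)"
  proof (rule bigoI)
    show "eventually (\<lambda>N. norm (real (m N)) \<le> (exp 2 + 1) * norm (real (d N) * real (k N) / \<epsilon> N)) sequentially"
      using ev
    proof eventually_elim
      case (elim N)
      have "norm (real (d N) * real (k N) / \<epsilon> N) = real (d N) * real (k N) / \<epsilon> N"
        using assms(3)[of N] by simp
      then show ?case using m[OF elim] by (simp only: norm_of_nat)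
    qed
  qed
  ultimately show ?thesis using RIP by blast
qed

end
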